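(* Let $q$ be an odd prime power with $q\equiv 2\pmod 3$, let $\mathbb{F}_q$ be the finite field with $q$ elements, of characteristic $p$, and let $a_1,a_2,\dots,a_{q-1}$ be all the nonzero elements of $\mathbb{F}_q$. Let $$T_q=\left[\frac{1}{a_i^2-a_ia_j+a_j^2}\right]_{1\le i,j\le q-1},$$ a $(q-1)\times(q-1)$ matrix over $\mathbb{F}_q$. Then $$\det T_q=(-1)^{\frac{q+1}{2}}\,2^{\frac{q-2}{3}}\in\mathbb{F}_p.$$
   Context: The elements $a_1,\dots,a_{q-1}$ are an enumeration, without repetition, of $\mathbb{F}_q^{\times}=\mathbb{F}_q\setminus\{0\}$. The same enumeration indexes the rows and columns of $T_q$. The prime field $\mathbb{F}_p$ is regarded as a subfield of $\mathbb{F}_q$, and integers are interpreted as their images in $\mathbb{F}_p$. *)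

theory Defs
  imports "Jordan_Normal_Form.Determinant" "HOL-Number_Theory.Prime_Powers" "HOL-Library.Cardinality"
begin

(* Matrices are 0-indexed here, whereas the enumeration a_1, ..., a_(q-1) starts at 1. *)
definition T_mat :: "nat \<Rightarrow> (nat \<Rightarrow> 'a :: field) \<Rightarrow> 'a mat" where
  "T_mat q a = mat (q - 1) (q - 1)
     (\<lambda>(i, j). 1 / (a (i + 1) ^ 2 - a (i + 1) * a (j + 1) + a (j + 1) ^ 2))"

definition is_subfield :: "'a :: field set \<Rightarrow> bool" where
  "is_subfield K \<longleftrightarrow>
     0 \<in> K \<and> 1 \<in> K \<and>
     (\<forall>x\<in>K. \<forall>y\<in>K. x - y \<in> K \<and> x * y \<in> K) \<and>
     (\<forall>x\<in>K. inverse x \<in> K)"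

definition prime_subfield :: "'a :: field set" where
  "prime_subfield = \<Inter>{K. is_subfield K}"

end

(*
  Scaling column j of T_q by a_j^2 preserves the determinant and turns T_q into the matrix
  f(a_i/a_j) with f(t) = 1/(t^2 - t + 1). Writing f on the nonzero elements as a polynomial
  sum c_k t^k with k < q - 1 factors this matrix through power matrices, and orthogonality of
  the characters t -> t^k gives det T_q as the product of the c_k. The c_k satisfy
  c_k - c_(k-1) + c_(k-2) = [k = 0] with indices modulo q - 1 = 4 (mod 6), so that 3 c_k runs
  through 1, 2, 1, -1, -2, -1 periodically.
*)
theory Submission
  imports Defs "HOL-Number_Theory.Residues"
begin

section \<open>Power sums and products over the nonzero elements of a finite field\<close>

lemma finite_field_power_card_minus_1:
  fixes x :: "'a :: finite_field"
  assumes "x \<noteq> 0"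
  shows "x ^ (CARD('a) - 1) = 1"
proof -
  have "x ^ (CARD('a) - 1) * x = x"
    unfolding power_Suc2[symmetric]
    using finite_field_power_card_eq_same[of x] finite_UNIV_card_ge_0[where 'a = 'a] by simp
  with assms show ?thesis by (metis mult_cancel_right1)
qed

text \<open>Otherwise all \<open>CARD('a) - 1\<close> nonzero elements would be roots of
  \<open>X ^ m - 1\<close>, whose degree \<open>m\<close> is smaller.\<close>

lemma exists_power_neq_1:
  assumes "0 < m" "m < CARD('a :: finite_field) - 1"
  shows "\<exists>g :: 'a. g \<noteq> 0 \<and> g ^ m \<noteq> 1"
proof (rule ccontr)
  assume "\<not> ?thesis"
  hence sub: "UNIV - {0 :: 'a} \<subseteq> {x. poly (Polynomial.monom 1 m - 1) x = 0}"
    by (auto simp: poly_monom)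
  have deg: "Polynomial.degree (Polynomial.monom 1 m - 1 :: 'a poly) \<le> m"
    by (intro degree_diff_le) (auto simp: Polynomial.degree_monom_eq)
  have "poly (Polynomial.monom 1 m - 1 :: 'a poly) 0 \<noteq> 0"
    using assms by (simp add: poly_monom power_0_left)
  hence nz: "Polynomial.monom 1 m - 1 \<noteq> (0 :: 'a poly)" by force
  have "card (UNIV - {0 :: 'a}) \<le> card {x :: 'a. poly (Polynomial.monom 1 m - 1) x = 0}"
    by (intro card_mono sub) simp
  also have "\<dots> \<le> m"
    using card_poly_roots_bound[OF nz] deg by linarith
  finally show False using assms by (simp add: card_Diff_singleton)
qed

text \<open>Multiplication by \<open>g\<close> permutes the nonzero elements and so scales the sum
  by \<open>g ^ m\<close>; the sum vanishes if some \<open>g ^ m\<close> differs from 1. Otherwise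
  every summand is 1 and the sum is \<open>CARD('a) - 1\<close>, which is -1 in the field.\<close>

lemma sum_power_nonzero_finite_field:
  "(\<Sum>x \<in> UNIV - {0 :: 'a :: finite_field}. x ^ m) = (if CARD('a) - 1 dvd m then -1 else 0)"
proof (cases "CARD('a) - 1 dvd m")
  case True
  then obtain k where k: "m = (CARD('a) - 1) * k" ..
  have "(\<Sum>x \<in> UNIV - {0 :: 'a}. x ^ m) = (\<Sum>x \<in> UNIV - {0 :: 'a}. 1)"
    by (intro sum.cong) (auto simp: k power_mult finite_field_power_card_minus_1 simp del: One_nat_def)
  also have "\<dots> = of_nat (CARD('a) - 1)"
    by (simp add: card_Diff_singleton)
  also have "\<dots> = of_nat (CARD('a)) - 1"
    by (simp add: of_nat_diff Suc_leI)
  also have "of_nat (CARD('a)) = (0 :: 'a)"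
    using CHAR_dvd_CARD[where 'a = 'a] by (simp only: of_nat_eq_0_iff_char_dvd)
  finally show ?thesis using True by simp
next
  case False
  let ?n = "CARD('a) - 1"
  have "?n > 0"
    using card_mono[of "UNIV :: 'a set" "{0, 1}"] by simp
  hence "0 < m mod ?n" "m mod ?n < ?n"
    using False by (auto simp: dvd_eq_mod_eq_0)
  from exists_power_neq_1[OF this] obtain g :: 'a where g: "g \<noteq> 0" "g ^ (m mod ?n) \<noteq> 1"
    by blast
  have "g ^ m = g ^ (?n * (m div ?n) + m mod ?n)" by simp
  also have "\<dots> = g ^ (m mod ?n)"
    unfolding power_add power_mult finite_field_power_card_minus_1[OF g(1)] by simp
  finally have gm: "g ^ m \<noteq> 1" using g by simp
  have "(\<Sum>x \<in> UNIV - {0 :: 'a}. x ^ m) = (\<Sum>x \<in> UNIV - {0 :: 'a}. (g * x) ^ m)"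
    by (rule sum.reindex_bij_witness[where i = "\<lambda>x. g * x" and j = "\<lambda>x. x / g"])
       (use g in auto)
  also have "\<dots> = g ^ m * (\<Sum>x \<in> UNIV - {0 :: 'a}. x ^ m)"
    by (simp add: power_mult_distrib sum_distrib_left)
  finally show ?thesis using gm False by (simp add: mult_cancel_right1)
qed

text \<open>Inversion permutes the nonzero elements, so the product equals its own inverse. This is
  why scaling the columns by squares preserves the determinant.\<close>

lemma prod_nonzero_power2: "(\<Prod>x \<in> UNIV - {0 :: 'a :: finite_field}. x) ^ 2 = 1"
proof -
  have "(\<Prod>x \<in> UNIV - {0 :: 'a}. x) = (\<Prod>x \<in> UNIV - {0 :: 'a}. inverse x)"
    by (rule prod.reindex_bij_witness[where i = inverse and j = inverse]) auto
  hence "(\<Prod>x \<in> UNIV - {0 :: 'a}. x) ^ 2 = (\<Prod>x \<in> UNIV - {0 :: 'a}. x * inverse x)"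
    unfolding power2_eq_square prod.distrib by metis
  also have "\<dots> = (\<Prod>x \<in> UNIV - {0 :: 'a}. 1)"
    by (intro prod.cong) auto
  finally show ?thesis by simp
qed

section \<open>Determinants diagonalized by characters\<close>

lemma det_mat_diag: "det (mat_diag n c) = (\<Prod>k<n. c k)"
proof -
  have "det (mat_diag n c) = prod_list (diag_mat (mat_diag n c))"
    by (rule det_upper_triangular[of _ n]) (auto simp: mat_diag_def)
  also have "diag_mat (mat_diag n c) = map c [0..<n]"
    by (auto simp: diag_mat_def mat_diag_def)
  also have "prod_list \<dots> = (\<Prod>k<n. c k)"
    by (simp add: prod.distinct_set_conv_list flip: atLeast0LessThan set_upt)
  finally show ?thesis .
qed

text \<open>A determinant of the multiplicative group, evaluated by its characters \<open>t \<mapsto> t ^ k\<close>;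
  the factor \<open>b j ^ (n - k)\<close> is \<open>(1 / b j) ^ k\<close>.\<close>

lemma det_power_expansion:
  fixes b :: "nat \<Rightarrow> 'a :: finite_field"
  assumes n: "n = CARD('a) - 1" and b: "bij_betw b {..<n} (UNIV - {0})"
  shows "det (mat n n (\<lambda>(i, j). \<Sum>k<n. c k * b i ^ k * b j ^ (n - k))) = (-1) ^ n * (\<Prod>k<n. c k)"
proof -
  define V where "V = mat n n (\<lambda>(i, k). b i ^ k)"
  define W where "W = mat n n (\<lambda>(k, j). b j ^ (n - k))"
  have carrier: "V \<in> carrier_mat n n" "W \<in> carrier_mat n n" "mat_diag n c * W \<in> carrier_mat n n"
    by (auto simp: V_def W_def mat_diag_def)
  have DW: "mat_diag n c * W = mat n n (\<lambda>(i, j). c i * b j ^ (n - i))"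
    by (subst mat_diag_mult_left[OF carrier(2)]) (auto simp: W_def)
  have "mat n n (\<lambda>(i, j). \<Sum>k<n. c k * b i ^ k * b j ^ (n - k)) = V * (mat_diag n c * W)"
    unfolding DW by (rule eq_matI)
      (auto simp: V_def scalar_prod_def atLeast0LessThan intro!: sum.cong)
  hence "det (mat n n (\<lambda>(i, j). \<Sum>k<n. c k * b i ^ k * b j ^ (n - k)))
      = (\<Prod>k<n. c k) * det (W * V)"
    using carrier by (simp add: det_mult[where n = n] det_mat_diag)
  \<comment> \<open>In this order the inner index runs over the field elements, so each entry is a
    power sum.\<close>
  also have "W * V = (-1) \<cdot>\<^sub>m 1\<^sub>m n"
  proof (rule eq_matI)
    fix k l assume "k < dim_row ((-1) \<cdot>\<^sub>m 1\<^sub>m n :: 'a mat)" "l < dim_col ((-1) \<cdot>\<^sub>m 1\<^sub>m n :: 'a mat)"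
    hence kl: "k < n" "l < n" by auto
    have "(W * V) $$ (k, l) = (\<Sum>j<n. b j ^ (n - k + l))"
      using kl by (simp add: V_def W_def scalar_prod_def atLeast0LessThan power_add del: Nat.add_diff_assoc2)
    also have "\<dots> = (\<Sum>x \<in> UNIV - {0}. x ^ (n - k + l))"
      by (rule sum.reindex_bij_betw[OF b])
    also have "\<dots> = (if n dvd n - k + l then -1 else 0)"
      by (simp add: sum_power_nonzero_finite_field n)
    \<comment> \<open>The exponent lies strictly between 0 and \<open>2 * n\<close>, so
      \<open>n\<close> is the only multiple it can equal.\<close>
    also have "n dvd n - k + l \<longleftrightarrow> k = l"
    proof
      assume "n dvd n - k + l"
      then obtain r where r: "n - k + l = n * r" ..
      have "0 < n * r" "n * r < n * 2" unfolding r[symmetric] using kl by auto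
      hence "r = 1" by (simp add: mult_less_cancel1)
      thus "k = l" using r kl by auto
    qed (use kl in auto)
    finally show "(W * V) $$ (k, l) = ((-1) \<cdot>\<^sub>m 1\<^sub>m n) $$ (k, l)"
      using kl by simp
  qed (auto simp: V_def W_def)
  also have "det \<dots> = (-1) ^ n" by simp
  finally show ?thesis by (simp add: mult.commute)
qed

section \<open>The coefficients of period six\<close>

text \<open>The coefficients of \<open>3 / (t^2 - t + 1)\<close> on the nonzero elements; not its power series.\<close>

definition sixth_coeff :: "nat \<Rightarrow> 'a :: comm_ring_1" where
  "sixth_coeff k = (-1) ^ (k div 3) * (if k mod 3 = 1 then 2 else 1)"

text \<open>The \<open>Suc\<close> forms match the terms that \<open>sum.lessThan_Suc\<close> and
  \<open>prod.lessThan_Suc\<close> split off.\<close>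

lemma sixth_coeff_block:
  "sixth_coeff (3 * r) = (-1 :: 'a :: comm_ring_1) ^ r"
  "sixth_coeff (Suc (3 * r)) = 2 * (-1 :: 'a) ^ r"
  "sixth_coeff (Suc (Suc (3 * r))) = (-1 :: 'a) ^ r"
proof -
  have "Suc (3 * r) div 3 = r" "Suc (3 * r) mod 3 = 1"
    "Suc (Suc (3 * r)) div 3 = r" "Suc (Suc (3 * r)) mod 3 = 2"
    by presburger+
  thus "sixth_coeff (3 * r) = (-1 :: 'a) ^ r" "sixth_coeff (Suc (3 * r)) = 2 * (-1 :: 'a) ^ r"
    "sixth_coeff (Suc (Suc (3 * r))) = (-1 :: 'a) ^ r"
    by (simp_all add: sixth_coeff_def)
qed

text \<open>Block \<open>r\<close> contributes \<open>(-1) ^ r * t ^ (3 * r) * (1 + t) ^ 2\<close>.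
  Since \<open>(t ^ 2 - t + 1) * (1 + t) = 1 + t ^ 3\<close>, the sum telescopes.\<close>

lemma sum_sixth_coeff:
  "(t ^ 2 - t + 1) * (\<Sum>k<3 * r. sixth_coeff k * t ^ k) = (1 + t) * (1 - (-1) ^ r * t ^ (3 * r))"
proof (induction r)
  case (Suc r)
  have "3 * Suc r = Suc (Suc (Suc (3 * r)))" by simp
  hence "(\<Sum>k<3 * Suc r. sixth_coeff k * t ^ k)
      = (\<Sum>k<3 * r. sixth_coeff k * t ^ k) + (-1) ^ r * t ^ (3 * r) * (1 + 2 * t + t ^ 2)"
    by (simp only: sum.lessThan_Suc sixth_coeff_block) (simp add: algebra_simps power2_eq_square)
  moreover have "(1 + t) * (1 - (-1) ^ r * t ^ (3 * r))
      + (t ^ 2 - t + 1) * ((-1) ^ r * t ^ (3 * r) * (1 + 2 * t + t ^ 2))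
      = (1 + t) * (1 - (-1) ^ Suc r * t ^ (3 * Suc r))"
    by (simp add: power_add algebra_simps power2_eq_square power3_eq_cube)
  ultimately show ?case by (simp add: Suc.IH distrib_left)
qed simp

lemma prod_sixth_coeff: "(\<Prod>k<6 * m. sixth_coeff k) = (-4) ^ m"
proof (induction m)
  case (Suc m)
  \<comment> \<open>One period consists of the blocks \<open>2 * m\<close> and
    \<open>2 * m + 1\<close>, with product \<open>2 * (-2)\<close>.\<close>
  have shift: "6 * m = 3 * (2 * m)" "Suc (Suc (Suc (3 * (2 * m)))) = 3 * (Suc (2 * m))"
    by simp_all
  have "6 * Suc m = Suc (Suc (Suc (Suc (Suc (Suc (6 * m))))))" by simp
  hence "(\<Prod>k<6 * Suc m. sixth_coeff k :: 'a) = (\<Prod>k<6 * m. sixth_coeff k) * (-4)"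
    by (simp only: prod.lessThan_Suc, simp only: shift sixth_coeff_block) (simp add: power_mult)
  thus ?case by (simp add: Suc.IH)
qed simp

text \<open>The range is \<open>2 * m + 1\<close> blocks and one further term,
  \<open>- t ^ (6 * m + 3)\<close>. By the hypothesis that power is the inverse of \<open>t\<close>,
  and everything but 3 cancels.\<close>

lemma sum_sixth_coeff_full:
  assumes "t ^ (6 * m + 4) = 1"
  shows "(t ^ 2 - t + 1) * (\<Sum>k<6 * m + 4. sixth_coeff k * t ^ k) = 3"
proof -
  let ?s = "t ^ (3 * (2 * m + 1))"
  have st: "?s * t = 1"
    unfolding power_Suc2[symmetric] using assms by (simp add: eval_nat_numeral algebra_simps)
  have "6 * m + 4 = Suc (3 * (2 * m + 1))" by simp
  hence "(\<Sum>k<6 * m + 4. sixth_coeff k * t ^ k)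
      = (\<Sum>k<3 * (2 * m + 1). sixth_coeff k * t ^ k) - ?s"
    by (simp only: sum.lessThan_Suc sixth_coeff_block) simp
  hence "(t ^ 2 - t + 1) * (\<Sum>k<6 * m + 4. sixth_coeff k * t ^ k)
      = (1 + t) * (1 + ?s) - (t ^ 2 - t + 1) * ?s"
    using sum_sixth_coeff[of t "2 * m + 1"] by (simp add: right_diff_distrib)
  also have "\<dots> = 1 + t + 2 * (?s * t) - t * (?s * t)"
    by (simp add: algebra_simps power2_eq_square)
  also have "\<dots> = 3" by (simp only: st) simp
  finally show ?thesis .
qed

text \<open>After \<open>m\<close> full periods the factors 1, 2, 1, -1 remain, which contribute
  -2.\<close>

lemma prod_sixth_coeff_full: "(\<Prod>k<6 * m + 4. sixth_coeff k) = (-1) ^ (m + 1) * 2 ^ (2 * m + 1)"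
proof -
  have shift: "6 * m = 3 * (2 * m)" "Suc (Suc (Suc (3 * (2 * m)))) = 3 * (Suc (2 * m))"
    by simp_all
  have "6 * m + 4 = Suc (Suc (Suc (Suc (6 * m))))" by simp
  hence "(\<Prod>k<6 * m + 4. sixth_coeff k :: 'a) = (\<Prod>k<6 * m. sixth_coeff k) * (-2)"
    by (simp only: prod.lessThan_Suc, simp only: shift sixth_coeff_block) (simp add: power_mult)
  also have "(-4 :: 'a) ^ m = (-1) ^ m * 2 ^ (2 * m)"
    by (simp add: power_mult flip: power_mult_distrib)
  ultimately show ?thesis by (simp add: prod_sixth_coeff)
qed

section \<open>The prime subfield and the evaluation of the determinant\<close>

lemma of_int_in_prime_subfield: "of_int z \<in> prime_subfield"
proof -
  have "of_int z \<in> K" if K: "is_subfield K" for K :: "'a set"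
  proof (induction z rule: int_induct[where k = 0])
    case base
    show ?case using K by (simp add: is_subfield_def)
  next
    case (step1 i)
    \<comment> \<open>\<open>is_subfield\<close> asks for closure under differences, so adding 1 is
      done by subtracting -1.\<close>
    have "0 - 1 \<in> K" using K unfolding is_subfield_def by blast
    hence "of_int i - (0 - 1) \<in> K" using K step1 unfolding is_subfield_def by blast
    thus ?case by simp
  next
    case (step2 i)
    have "of_int i - 1 \<in> K" using K step2 unfolding is_subfield_def by blast
    thus ?case by simp
  qed
  thus ?thesis by (auto simp: prime_subfield_def)
qed

theorem theorem1:
  fixes p q :: nat and a :: "nat \<Rightarrow> 'a :: finite_field"
  assumes "primepow q" and "odd q" and "q mod 3 = 2"
    and "CARD('a) = q" and "CHAR('a) = p"
    and "bij_betw a {1..q - 1} (UNIV - {0})"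
  shows "det (T_mat q a) = of_int ((-1) ^ ((q + 1) div 2) * 2 ^ ((q - 2) div 3))
    \<and> det (T_mat q a) \<in> prime_subfield"
proof -
  define m where "m = q div 6"
  define n where "n = q - 1"
  define b where "b i = a (i + 1)" for i
  define c :: "nat \<Rightarrow> 'a" where "c k = sixth_coeff k / 3" for k
  have q: "q = 6 * m + 5"
    using assms(2,3) unfolding m_def by presburger
  have n: "n = 6 * m + 4" "n = CARD('a) - 1"
    using q assms(4) by (simp_all add: n_def)
  have unit: "x ^ n = 1" if "x \<noteq> 0" for x :: 'a
    using finite_field_power_card_minus_1[OF that] n(2) by simp
  \<comment> \<open>Characteristic 3 would make \<open>q\<close> divisible by 3; this allows the
    division by 3 in \<open>c\<close>.\<close>
  have three: "(3 :: 'a) \<noteq> 0"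
  proof
    assume "(3 :: 'a) = 0"
    hence "of_nat 3 = (0 :: 'a)" by simp
    hence "CHAR('a) dvd 3" by (simp only: of_nat_eq_0_iff_char_dvd)
    moreover have "prime CHAR('a)" by (rule prime_CHAR_semidom) (simp add: finite_imp_CHAR_pos)
    ultimately have "CHAR('a) = 3" by (simp add: primes_dvd_imp_eq)
    hence "3 dvd q" using CHAR_dvd_CARD[where 'a = 'a] assms(4) by simp
    thus False using assms(3) by presburger
  qed
  have b: "bij_betw b {..<n} (UNIV - {0})"
  proof -
    have "bij_betw (\<lambda>i. i + 1) {..<n} {1..n}"
      by (rule bij_betwI[where g = "\<lambda>i. i - 1"]) auto
    from bij_betw_trans[OF this] show ?thesis
      using assms(6) by (simp add: n_def b_def[abs_def] o_def)
  qed
  have b0: "b i \<noteq> 0" if "i < n" for i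
    using bij_betwE[OF b] that by blast
  \<comment> \<open>The factor \<open>y ^ 2\<close> makes the entry a function of
    \<open>x / y\<close> alone.\<close>
  have entry: "1 / (x ^ 2 - x * y + y ^ 2) * y ^ 2 = (\<Sum>k<n. c k * x ^ k * y ^ (n - k))"
    if "x \<noteq> 0" "y \<noteq> 0" for x y :: 'a
  proof -
    define t where "t = x / y"
    define S where "S = (\<Sum>k<n. c k * t ^ k)"
    have "t ^ (6 * m + 4) = 1"
      using that unit[of t] by (simp add: t_def n)
    from sum_sixth_coeff_full[OF this] have "(t ^ 2 - t + 1) * S = 1"
      using three by (simp add: S_def c_def n flip: sum_divide_distrib)
    \<comment> \<open>The product being 1 also shows that \<open>t ^ 2 - t + 1\<close> is nonzero,
      so no denominator in the matrix vanishes.\<close>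
    hence "S = 1 / (t ^ 2 - t + 1)"
      by (metis eq_divide_eq mult.commute mult_zero_left zero_neq_one)
    also have "t ^ 2 - t + 1 = (x ^ 2 - x * y + y ^ 2) / y ^ 2"
      using that by (simp add: t_def field_simps power2_eq_square)
    also have "1 / \<dots> = 1 / (x ^ 2 - x * y + y ^ 2) * y ^ 2" by simp
    also have "S = (\<Sum>k<n. c k * x ^ k * y ^ (n - k))"
      unfolding S_def
    proof (intro sum.cong refl)
      fix k assume "k \<in> {..<n}"
      hence "y ^ (n - k) = 1 / y ^ k"
        using that unit[of y] by (simp add: power_diff)
      thus "c k * t ^ k = c k * x ^ k * y ^ (n - k)"
        by (simp add: t_def power_divide)
    qed
    finally show ?thesis ..
  qed
  have T_eq: "T_mat q a = mat n n (\<lambda>(i, j). 1 / (b i ^ 2 - b i * b j + b j ^ 2))"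
    by (simp add: T_mat_def n_def b_def)
  hence T: "T_mat q a \<in> carrier_mat n n" by simp
  have "T_mat q a * mat_diag n (\<lambda>j. b j ^ 2)
      = mat n n (\<lambda>(i, j). \<Sum>k<n. c k * b i ^ k * b j ^ (n - k))"
    by (subst mat_diag_mult_right[OF T], rule eq_matI)
       (auto simp: T_eq b0 entry[symmetric])
  hence "det (T_mat q a * mat_diag n (\<lambda>j. b j ^ 2)) = (-1) ^ n * (\<Prod>k<n. c k)"
    by (simp add: det_power_expansion[OF n(2) b])
  moreover have "(\<Prod>j<n. b j ^ 2) = 1"
    using prod.reindex_bij_betw[OF b, of "\<lambda>x. x"] prod_nonzero_power2[where 'a = 'a]
    by (simp only: prod_power_distrib[symmetric])
  ultimately have "det (T_mat q a) = (-1) ^ n * (\<Prod>k<n. c k)"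
    using T by (simp add: det_mult[where n = n] det_mat_diag)
  \<comment> \<open>The denominators multiply to \<open>3 ^ n = 1\<close>, and
    \<open>(-1) ^ n = 1\<close> because \<open>n\<close> is even.\<close>
  also have "\<dots> = (-1) ^ (m + 1) * 2 ^ (2 * m + 1)"
    using unit[OF three] prod_sixth_coeff_full[of m, where 'a = 'a]
    by (simp add: c_def prod_dividef n(1))
  also have "2 * m + 1 = (q - 2) div 3" using q by simp
  \<comment> \<open>Here \<open>(q + 1) div 2\<close> is \<open>3 * (m + 1)\<close>, of the same
    parity as \<open>m + 1\<close>.\<close>
  also have "(-1 :: 'a) ^ (m + 1) = (-1) ^ ((q + 1) div 2)"
  proof -
    have "(q + 1) div 2 = 2 * (m + 1) + (m + 1)" using q by simp
    thus ?thesis by (simp only: power_add power_mult) simp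
  qed
  finally have "det (T_mat q a) = of_int ((-1) ^ ((q + 1) div 2) * 2 ^ ((q - 2) div 3))"
    by simp
  thus ?thesis using of_int_in_prime_subfield by metis
qed

end
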